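(* Let $t>2$ be an integer. For any $n\ge1$, any nonnegative monotone submodular function $f:2^N\to\mathbb{R}_+$ with $N=\{1,\dots,n\}$, and any $\mathbf{x}\in[0,1]^n$, $$\frac{f^+(\mathbf{x})}{f^{(t)}(\mathbf{x})}\le\frac{e}{e-1}.$$ Moreover, the bound is asymptotically attained in the following setting. Let $m=m(n)$ be a sequence of positive integers with $m(n)\le n$, $m(n)\to\infty$ and $m(n)=o(n)$ as $n\to\infty$. For each $n$, partition $N=\{1,\dots,n\}$ into $m$ blocks $N=A_1\cup\cdots\cup A_m$ with $|A_r|=\ell=\lfloor n/m\rfloor$ for $1\le r\le m-1$ and $|A_m|=n-(m-1)\ell$. Let $\mathcal{H}_m=A_1\times\cdots\times A_m$ be the family of all $m$-element subsets $H\subseteq N$ obtained by choosing exactly one element from each block, let $f(S)=g_m(S)=\sum_{H\in\mathcal{H}_m}\mathbf{1}\{S\cap H\neq\emptyset\}$ for $S\subseteq N$, and let $\mathbf{x}^{\mathrm{id}}=(1/m,\dots,1/m)\in[0,1]^n$. Then $$\frac{f^+(\mathbf{x}^{\mathrm{id}})}{f^{(t)}(\mathbf{x}^{\mathrm{id}})}\longrightarrow\frac{e}{e-1}\qquad\text{as } n\to\infty.$$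
   Context: A set function $f:2^N\to\mathbb{R}_+$ is monotone if $f(S)\le f(T)$ for all $S\subseteq T\subseteq N$, and submodular if $f(S)+f(T)\ge f(S\cap T)+f(S\cup T)$ for all $S,T\subseteq N$. For $N=\{1,\dots,n\}$ and $\mathbf{x}\in[0,1]^n$, the concave closure $f^+(\mathbf{x})$ is the maximum of $\sum_{S\subseteq N}u_Sf(S)$ over all $(u_S)_{S\subseteq N}$ with $u_S\ge0$, $\sum_{S\subseteq N}u_S=1$ and $\sum_{S\ni i}u_S=x_i$ for all $i\in N$. The $t$-wise independent extension $f^{(t)}(\mathbf{x})$ is the maximum of $\sum_{S\subseteq N}p_Sf(S)$ over all $(p_S)_{S\subseteq N}$ with $p_S\ge0$, $\sum_{S\subseteq N}p_S=1$, and $$\sum_{S\supseteq\{i_1,\dots,i_r\}}p_S=\prod_{j=1}^r x_{i_j}\qquad\text{for all } i_1<\cdots<i_r \text{ in } N \text{ and all } 1\le r\le t.$$ The ratio is considered whenever $f^{(t)}(\mathbf{x})>0$. *)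

theory Defs
  imports Complex_Main "HOL-Library.FuncSet" "HOL-Library.Disjoint_Sets" "HOL-Library.Landau_Symbols"
begin

definition submodular_on :: "'a set \<Rightarrow> ('a set \<Rightarrow> real) \<Rightarrow> bool" where
  "submodular_on N f \<longleftrightarrow>
     (\<forall>S T. S \<subseteq> N \<longrightarrow> T \<subseteq> N \<longrightarrow> f S + f T \<ge> f (S \<inter> T) + f (S \<union> T))"

definition weights_on :: "'a set \<Rightarrow> ('a set \<Rightarrow> real) \<Rightarrow> bool" where
  "weights_on N p \<longleftrightarrow> (\<forall>S\<in>Pow N. p S \<ge> 0) \<and> (\<Sum>S\<in>Pow N. p S) = 1"

text \<open>
  Both extensions are maxima of a linear functional over a polytope. They are meant for finite
  \<open>N\<close> and \<open>x\<close> with values in \<open>[0, 1]\<close> on \<open>N\<close>; the polytope is then nonempty and compact, so the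
  greatest value exists.
\<close>

definition concave_closure :: "'a set \<Rightarrow> ('a set \<Rightarrow> real) \<Rightarrow> ('a \<Rightarrow> real) \<Rightarrow> real" where
  "concave_closure N f x =
     (GREATEST v. \<exists>u. weights_on N u \<and>
        (\<forall>i\<in>N. (\<Sum>S | S \<subseteq> N \<and> i \<in> S. u S) = x i) \<and>
        v = (\<Sum>S\<in>Pow N. u S * f S))"

text \<open>The index tuples \<open>i\<^sub>1 < \<dots> < i\<^sub>r\<close> with \<open>1 \<le> r \<le> t\<close> are represented by their sets \<open>I\<close> of entries.\<close>

definition twise_extension :: "nat \<Rightarrow> 'a set \<Rightarrow> ('a set \<Rightarrow> real) \<Rightarrow> ('a \<Rightarrow> real) \<Rightarrow> real" where
  "twise_extension t N f x =
     (GREATEST v. \<exists>p. weights_on N p \<and>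
        (\<forall>I. I \<subseteq> N \<and> 1 \<le> card I \<and> card I \<le> t \<longrightarrow>
           (\<Sum>S | S \<subseteq> N \<and> I \<subseteq> S. p S) = (\<Prod>i\<in>I. x i)) \<and>
        v = (\<Sum>S\<in>Pow N. p S * f S))"

definition block_partition :: "nat \<Rightarrow> nat \<Rightarrow> (nat \<Rightarrow> nat set) \<Rightarrow> bool" where
  "block_partition n m A \<longleftrightarrow>
     (\<Union>r\<in>{1..m}. A r) = {1..n} \<and> disjoint_family_on A {1..m} \<and>
     (\<forall>r\<in>{1..m - 1}. card (A r) = n div m) \<and>
     card (A m) = n - (m - 1) * (n div m)"

text \<open>The product \<open>A\<^sub>1 \<times> \<dots> \<times> A\<^sub>m\<close>, each tuple being replaced by the set of its entries.\<close>

definition transversals :: "nat \<Rightarrow> (nat \<Rightarrow> 'a set) \<Rightarrow> 'a set set" where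
  "transversals m A = (\<lambda>h. h ` {1..m}) ` (\<Pi>\<^sub>E r\<in>{1..m}. A r)"

definition hit_count :: "nat \<Rightarrow> (nat \<Rightarrow> 'a set) \<Rightarrow> 'a set \<Rightarrow> real" where
  "hit_count m A S = (\<Sum>H\<in>transversals m A. of_bool (S \<inter> H \<noteq> {}))"

end

(* The independent distribution is t-wise independent, so f^(t) dominates the multilinear extension,
   and the first part follows from the correlation gap. For f = g_m, f^+(x) is the number M of
   transversals. If Y_r is the proportion of the block A_r lying in the random set, then
   g_m / M = 1 - prod (1 - Y_r), and prod (1 - Y_r) >= exp(-1) (2 - sum Y_r) - sum Y_r^2; under a
   pairwise independent distribution sum Y_r has mean 1 while sum Y_r^2 has mean at most
   1/l + 1/m with l = floor(n/m), so f^(t)(x) / M cannot exceed 1 - 1/e + o(1). *)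

theory Submission
  imports Defs "HOL-Analysis.Function_Topology"
begin

section \<open>Attainment of the two maxima\<close>

text \<open>\<open>GREATEST\<close> says nothing about a supremum that is not attained, so
  compactness of both feasible sets has to be proved before either extension can be compared with
  anything. For g_m the obstacle is that prod (1 - Y_r) is a polynomial of degree m in the
  indicators of the points, with m growing, whereas t-wise independence fixes only moments of order
  at most t. The lower bound cited above removes the high degree. If s = sum Y_r, the product
  differs from exp(-s) by at most sum Y_r^2, and exp(-1) (2 - s) is the tangent of exp(-s) at s = 1.
  The tangent point is the mean of s, so taking expectations turns the linear term into exactly
  exp(-1), whatever the joint law of the blocks. In the error term, 1/l comes from the diagonal
  pairs (i, i) inside a block and 1/m from pairs of distinct points. The first vanishes because m =
  o(n), the second because m tends to infinity.\<close>

definition moment_polytope :: "'a set \<Rightarrow> 'b set \<Rightarrow> ('b \<Rightarrow> 'a set set) \<Rightarrow> ('b \<Rightarrow> real) \<Rightarrow> ('a set \<Rightarrow> real) set" where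
  "moment_polytope N J B c = {p. weights_on N p \<and> (\<forall>j\<in>J. (\<Sum>S\<in>B j. p S) = c j)}"

text \<open>Weights are total functions whose values outside \<open>Pow N\<close> are arbitrary;
  membership ignores them, so they may be normalised by \<open>restrict\<close>.\<close>

lemma moment_polytope_cong:
  assumes "p \<in> moment_polytope N J B c" "\<And>j. j \<in> J \<Longrightarrow> B j \<subseteq> Pow N" "\<And>S. S \<in> Pow N \<Longrightarrow> q S = p S"
  shows "q \<in> moment_polytope N J B c"
proof -
  have "(\<Sum>S\<in>B j. q S) = (\<Sum>S\<in>B j. p S)" if "j \<in> J" for j
    using assms(2)[OF that] assms(3) by (intro sum.cong) auto
  moreover have "(\<Sum>S\<in>Pow N. q S) = (\<Sum>S\<in>Pow N. p S)"
    using assms(3) by (intro sum.cong) auto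
  ultimately show ?thesis
    using assms(1,3) by (auto simp: moment_polytope_def weights_on_def)
qed

text \<open>A continuous functional on a nonempty compact set attains its maximum. Both extensions
  are instances: \<open>B j\<close> consists of the supersets of a point or of an index set, and
  \<open>c j\<close> is the prescribed mass.\<close>

lemma moment_polytope_attains_Greatest:
  fixes f :: "'a set \<Rightarrow> real"
  assumes "finite N" and B: "\<And>j. j \<in> J \<Longrightarrow> B j \<subseteq> Pow N"
    and nonempty: "moment_polytope N J B c \<noteq> {}"
  defines "G \<equiv> (GREATEST v. \<exists>p\<in>moment_polytope N J B c. v = (\<Sum>S\<in>Pow N. p S * f S))"
  shows "\<exists>p\<in>moment_polytope N J B c. G = (\<Sum>S\<in>Pow N. p S * f S)"
    and "\<forall>p\<in>moment_polytope N J B c. (\<Sum>S\<in>Pow N. p S * f S) \<le> G"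
proof -
  let ?Q = "moment_polytope N J B c"
  let ?E = "\<lambda>p. \<Sum>S\<in>Pow N. p S * f S"
  let ?C = "PiE (Pow N) (\<lambda>_. {0..1::real})"
  let ?K = "?C \<inter> ?Q"
  have "compact ?C"
  proof -
    \<comment> \<open>The one-point factors outside \<open>Pow N\<close> present the cube of
      extensional functions as a product over all sets, so Tychonoff applies in the full function
      space.\<close>
    let ?S = "\<lambda>S. if S \<in> Pow N then {0..1::real} else {undefined}"
    have "compactin (product_topology (\<lambda>_. euclidean) UNIV) (PiE UNIV ?S)"
      unfolding compactin_PiE by simp
    moreover have "PiE UNIV ?S = ?C"
      unfolding PiE_def extensional_def Pi_def by (auto split: if_splits)
    ultimately show ?thesis
      by (simp add: euclidean_product_topology)
  qed
  moreover have "closed ?Q"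
    unfolding moment_polytope_def weights_on_def Ball_def
    by (intro closed_Collect_conj closed_Collect_all closed_Collect_imp closed_Collect_le
          closed_Collect_eq continuous_intros open_Collect_const) auto
  ultimately have "compact ?K"
    by blast
  have restrict_in: "restrict p (Pow N) \<in> ?K" "?E (restrict p (Pow N)) = ?E p" if p: "p \<in> ?Q" for p
  proof -
    have "p S \<in> {0..1}" if S: "S \<in> Pow N" for S
    proof -
      have w: "weights_on N p"
        using p by (simp add: moment_polytope_def)
      then have "p S \<le> (\<Sum>T\<in>Pow N. p T)"
        using S \<open>finite N\<close> by (intro member_le_sum) (auto simp: weights_on_def)
      with w S show ?thesis
        by (auto simp: weights_on_def)
    qed
    moreover have "restrict p (Pow N) \<in> ?Q"
      using p B by (rule moment_polytope_cong) auto
    ultimately show "restrict p (Pow N) \<in> ?K"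
      by auto
    show "?E (restrict p (Pow N)) = ?E p"
      by (rule sum.cong) auto
  qed
  have "?K \<noteq> {}"
    using nonempty restrict_in(1) by blast
  moreover have "continuous_on ?K ?E"
    by (rule continuous_on_subset[OF _ subset_UNIV])
       (intro continuous_intros continuous_on_product_coordinates)
  ultimately have "\<exists>q\<in>?K. \<forall>p\<in>?K. ?E p \<le> ?E q"
    by (rule continuous_attains_sup[OF \<open>compact ?K\<close>])
  then obtain q where q: "q \<in> ?K" "\<forall>p\<in>?K. ?E p \<le> ?E q" ..
  have max: "?E p \<le> ?E q" if "p \<in> ?Q" for p
    using q(2)[rule_format, OF restrict_in(1)[OF that]] unfolding restrict_in(2)[OF that] .
  have "G = ?E q"
    unfolding G_def by (rule Greatest_equality) (use q(1) max in auto)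
  then show "\<exists>p\<in>?Q. G = ?E p" "\<forall>p\<in>?Q. ?E p \<le> G"
    using q(1) max by auto
qed

section \<open>The independent distribution\<close>

definition indep_weight :: "'a set \<Rightarrow> ('a \<Rightarrow> real) \<Rightarrow> 'a set \<Rightarrow> real" where
  "indep_weight N x S = (\<Prod>i\<in>N. if i \<in> S then x i else 1 - x i)"

lemma indep_weight_nonneg:
  "(\<And>i. i \<in> N \<Longrightarrow> 0 \<le> x i \<and> x i \<le> 1) \<Longrightarrow> 0 \<le> indep_weight N x S"
  unfolding indep_weight_def by (rule prod_nonneg) auto

text \<open>Expand the product of \<open>x i + ?g i\<close> over subsets. The zero factors on
  \<open>I\<close> kill every \<open>S\<close> that misses a point of \<open>I\<close>, and outside
  \<open>I\<close> the two summands add up to 1. With \<open>I\<close> empty this is the total mass;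
  in general it is independence of every order.\<close>

lemma sum_indep_weight_superset:
  assumes "finite N" "I \<subseteq> N"
  shows "(\<Sum>S | S \<subseteq> N \<and> I \<subseteq> S. indep_weight N x S) = (\<Prod>i\<in>I. x i)"
proof -
  let ?g = "\<lambda>i. if i \<in> I then 0 else 1 - x i"
  have "(\<Sum>S | S \<subseteq> N \<and> I \<subseteq> S. indep_weight N x S) =
        (\<Sum>S\<in>Pow N. if I \<subseteq> S then indep_weight N x S else 0)"
    using assms by (intro sum.mono_neutral_cong_left) auto
  also have "\<dots> = (\<Sum>S\<in>Pow N. (\<Prod>i\<in>S. x i) * (\<Prod>i\<in>N-S. ?g i))"
  proof (rule sum.cong[OF refl])
    fix S assume S: "S \<in> Pow N"
    then have fin: "finite S" "finite (N - S)"
      using assms finite_subset by auto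
    show "(if I \<subseteq> S then indep_weight N x S else 0) = (\<Prod>i\<in>S. x i) * (\<Prod>i\<in>N-S. ?g i)"
    proof (cases "I \<subseteq> S")
      case True
      have "indep_weight N x S = (\<Prod>i\<in>S. x i) * (\<Prod>i\<in>N-S. 1 - x i)"
        unfolding indep_weight_def using S assms
        by (subst prod.If_cases) (auto simp: Int_absorb1 Diff_eq)
      also have "(\<Prod>i\<in>N-S. 1 - x i) = (\<Prod>i\<in>N-S. ?g i)"
        using True by (intro prod.cong) auto
      finally show ?thesis using True by simp
    next
      case False
      then show ?thesis
        using assms fin by (auto simp: prod_zero_iff subset_iff)
    qed
  qed
  also have "\<dots> = (\<Prod>i\<in>N. x i + ?g i)"
    using assms by (simp add: prod_add)
  also have "\<dots> = (\<Prod>i\<in>I. x i)"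
    using assms by (intro prod.mono_neutral_cong_right) auto
  finally show ?thesis .
qed

lemma weights_on_indep_weight:
  assumes "finite N" "\<And>i. i \<in> N \<Longrightarrow> 0 \<le> x i \<and> x i \<le> 1"
  shows "weights_on N (indep_weight N x)"
  using sum_indep_weight_superset[OF assms(1), of "{}" x] indep_weight_nonneg[of N x] assms(2)
  by (simp add: weights_on_def Pow_def)

lemma sum_Pow_remove:
  assumes "finite N" "i \<in> N"
  shows "(\<Sum>S\<in>Pow N. g S) = (\<Sum>S\<in>Pow (N - {i}). g S + g (insert i S))"
proof -
  have "Pow N = Pow (N - {i}) \<union> insert i ` Pow (N - {i})"
    using assms(2) Pow_insert[of i "N - {i}"] by (simp add: insert_absorb)
  then have "(\<Sum>S\<in>Pow N. g S) = (\<Sum>S\<in>Pow (N - {i}) \<union> insert i ` Pow (N - {i}). g S)"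
    by simp
  also have "\<dots> = (\<Sum>S\<in>Pow (N - {i}). g S) + (\<Sum>S\<in>insert i ` Pow (N - {i}). g S)"
    using assms(1) by (intro sum.union_disjoint) auto
  also have "(\<Sum>S\<in>insert i ` Pow (N - {i}). g S) = (\<Sum>S\<in>Pow (N - {i}). g (insert i S))"
    by (subst sum.reindex) (auto simp: inj_on_def)
  finally show ?thesis
    by (simp add: sum.distrib)
qed

lemma indep_weight_remove:
  assumes "finite N" "i \<in> N"
  shows "indep_weight N x S = (if i \<in> S then x i else 1 - x i) * indep_weight (N - {i}) x S"
  unfolding indep_weight_def using assms by (rule prod.remove)

lemma indep_weight_insert:
  "indep_weight (N - {i}) x (insert i S) = indep_weight (N - {i}) x S"
  unfolding indep_weight_def by (rule prod.cong) auto

section \<open>The correlation gap\<close>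

text \<open>Diminishing returns: by submodularity for \<open>S \<union> T\<close> and
  \<open>insert i S\<close>, adding \<open>i\<close> to \<open>S \<union> T\<close> gains no more
  than adding it to \<open>S\<close>.\<close>

lemma submodular_on_le_sum_marginals:
  assumes f: "submodular_on N f" and "S \<subseteq> N" "finite T" "T \<subseteq> N"
  shows "f (S \<union> T) \<le> f S + (\<Sum>i\<in>T. f (insert i S) - f S)"
  using assms(3,4)
proof (induction T rule: finite_induct)
  case (insert i T)
  show ?case
  proof (cases "i \<in> S")
    case True
    then have "S \<union> insert i T = S \<union> T" "insert i S = S"
      by auto
    then show ?thesis
      using insert by simp
  next
    case False
    have "f (S \<union> T) + f (insert i S) \<ge> f ((S \<union> T) \<inter> insert i S) + f ((S \<union> T) \<union> insert i S)"
      using f[unfolded submodular_on_def, rule_format, of "S \<union> T" "insert i S"]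
        insert.prems \<open>S \<subseteq> N\<close> by auto
    moreover have "(S \<union> T) \<inter> insert i S = S" "(S \<union> T) \<union> insert i S = S \<union> insert i T"
      using insert.hyps False by auto
    ultimately show ?thesis
      using insert by simp
  qed
qed simp

text \<open>Average \<open>f T \<le> f (S \<union> T)\<close> over \<open>u\<close>, after bounding
  the right side by single-element gains. The result depends on \<open>u\<close> only through its
  marginals, so arbitrary correlations are covered.\<close>

lemma expectation_le_marginals:
  assumes "finite N" and mono: "mono_on (Pow N) f" and f: "submodular_on N f"
    and u: "weights_on N u" "\<And>i. i \<in> N \<Longrightarrow> (\<Sum>S | S \<subseteq> N \<and> i \<in> S. u S) = x i"
    and "S \<subseteq> N"
  shows "(\<Sum>T\<in>Pow N. u T * f T) \<le> f S + (\<Sum>i\<in>N. x i * (f (insert i S) - f S))"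
proof -
  let ?d = "\<lambda>i. f (insert i S) - f S"
  have "f T \<le> f S + (\<Sum>i\<in>N. of_bool (i \<in> T) * ?d i)" if "T \<in> Pow N" for T
  proof -
    have "finite T"
      using that assms(1) finite_subset by auto
    have "f T \<le> f (S \<union> T)"
      using that \<open>S \<subseteq> N\<close> by (intro mono_onD[OF mono]) auto
    also have "\<dots> \<le> f S + (\<Sum>i\<in>T. ?d i)"
      using submodular_on_le_sum_marginals[OF f \<open>S \<subseteq> N\<close> \<open>finite T\<close>] that by auto
    also have "(\<Sum>i\<in>T. ?d i) = (\<Sum>i\<in>N. of_bool (i \<in> T) * ?d i)"
      using that assms(1) by (intro sum.mono_neutral_cong_left) auto
    finally show ?thesis .
  qed
  then have "(\<Sum>T\<in>Pow N. u T * f T) \<le> (\<Sum>T\<in>Pow N. u T * (f S + (\<Sum>i\<in>N. of_bool (i \<in> T) * ?d i)))"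
    using u(1) by (intro sum_mono mult_left_mono) (auto simp: weights_on_def)
  also have "\<dots> = (\<Sum>T\<in>Pow N. u T) * f S + (\<Sum>T\<in>Pow N. \<Sum>i\<in>N. u T * of_bool (i \<in> T) * ?d i)"
    by (simp add: distrib_left sum.distrib sum_distrib_right sum_distrib_left mult.assoc)
  also have "(\<Sum>T\<in>Pow N. \<Sum>i\<in>N. u T * of_bool (i \<in> T) * ?d i) =
      (\<Sum>i\<in>N. (\<Sum>T\<in>Pow N. u T * of_bool (i \<in> T)) * ?d i)"
    by (subst sum.swap) (simp add: sum_distrib_right)
  also have "\<dots> = (\<Sum>i\<in>N. x i * ?d i)"
  proof (rule sum.cong[OF refl])
    fix i assume "i \<in> N"
    have "(\<Sum>T\<in>Pow N. u T * of_bool (i \<in> T)) = (\<Sum>S | S \<subseteq> N \<and> i \<in> S. u S)"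
      using assms(1) by (intro sum.mono_neutral_cong_right) auto
    with u(2)[OF \<open>i \<in> N\<close>] show "(\<Sum>T\<in>Pow N. u T * of_bool (i \<in> T)) * ?d i = x i * ?d i"
      by simp
  qed
  finally show ?thesis
    using u(1) by (simp add: weights_on_def)
qed

text \<open>Differentiating the factor of \<open>i\<close> gives \<open>x i\<close> or
  \<open>- x i\<close> according to whether \<open>i \<in> S\<close>; pairing \<open>S\<close> with
  \<open>insert i S\<close> turns these signs into gains of \<open>f\<close>.\<close>

lemma has_field_derivative_multilinear:
  assumes "finite N"
  shows "((\<lambda>s. \<Sum>S\<in>Pow N. indep_weight N (\<lambda>i. s * x i) S * f S) has_field_derivative
    (\<Sum>i\<in>N. x i * (\<Sum>S\<in>Pow (N - {i}). indep_weight (N - {i}) (\<lambda>i. s * x i) S * (f (insert i S) - f S))))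
    (at s)"
proof -
  let ?W = "\<lambda>i. indep_weight (N - {i}) (\<lambda>i. s * x i)"
  let ?e = "\<lambda>i S. if i \<in> S then x i else - x i"
  have "((\<lambda>s. indep_weight N (\<lambda>i. s * x i) S) has_field_derivative (\<Sum>i\<in>N. ?e i S * ?W i S)) (at s)" for S
    unfolding indep_weight_def
    by (rule has_field_derivative_prod) (auto intro!: derivative_eq_intros)
  then have "((\<lambda>s. \<Sum>S\<in>Pow N. indep_weight N (\<lambda>i. s * x i) S * f S) has_field_derivative
      (\<Sum>S\<in>Pow N. (\<Sum>i\<in>N. ?e i S * ?W i S) * f S)) (at s)"
    by (intro DERIV_sum DERIV_cmult_right)
  moreover have "(\<Sum>S\<in>Pow N. (\<Sum>i\<in>N. ?e i S * ?W i S) * f S) =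
      (\<Sum>i\<in>N. \<Sum>S\<in>Pow N. ?e i S * ?W i S * f S)"
    by (subst sum.swap) (simp add: sum_distrib_right)
  moreover have "(\<Sum>S\<in>Pow N. ?e i S * ?W i S * f S) =
      x i * (\<Sum>S\<in>Pow (N - {i}). ?W i S * (f (insert i S) - f S))" if "i \<in> N" for i
    unfolding sum_Pow_remove[OF assms that] sum_distrib_left
    by (rule sum.cong) (auto simp: indep_weight_insert algebra_simps)
  ultimately show ?thesis
    by simp
qed

text \<open>Along the ray \<open>s \<mapsto> s * x\<close> the multilinear extension \<open>\<phi>\<close> satisfies \<open>\<phi>' \<ge> c - \<phi>\<close>, where \<open>c\<close> is
  the expectation under \<open>u\<close>; hence \<open>exp s * (\<phi> s - c)\<close> is nondecreasing.\<close>

theorem correlation_gap: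
  assumes "finite N" and nonneg: "\<And>S. S \<subseteq> N \<Longrightarrow> f S \<ge> 0"
    and mono: "mono_on (Pow N) f" and f: "submodular_on N f"
    and x: "\<And>i. i \<in> N \<Longrightarrow> 0 \<le> x i \<and> x i \<le> 1"
    and u: "weights_on N u" "\<And>i. i \<in> N \<Longrightarrow> (\<Sum>S | S \<subseteq> N \<and> i \<in> S. u S) = x i"
  shows "(1 - exp (-1)) * (\<Sum>S\<in>Pow N. u S * f S) \<le> (\<Sum>S\<in>Pow N. indep_weight N x S * f S)"
proof -
  define c where "c = (\<Sum>S\<in>Pow N. u S * f S)"
  define W where "W s M = indep_weight M (\<lambda>i. s * x i)" for s M
  define \<phi> where "\<phi> s = (\<Sum>S\<in>Pow N. W s N S * f S)" for s
  define \<phi>' where "\<phi>' s = (\<Sum>i\<in>N. x i * (\<Sum>S\<in>Pow (N - {i}). W s (N - {i}) S * (f (insert i S) - f S)))" for s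
  have deriv: "(\<phi> has_field_derivative \<phi>' s) (at s)" for s
    unfolding \<phi>_def \<phi>'_def W_def by (rule has_field_derivative_multilinear[OF assms(1)])
  have sx: "0 \<le> s * x i \<and> s * x i \<le> 1" if "0 \<le> s" "s \<le> 1" "i \<in> N" for s i
    using x[OF that(3)] that by (auto intro: mult_le_one)
  have W_nonneg: "0 \<le> W s M S" if "0 \<le> s" "s \<le> 1" "M \<subseteq> N" for s M S
    unfolding W_def using sx[OF that(1,2)] that(3) by (intro indep_weight_nonneg) auto
  have \<phi>'_ge: "c - \<phi> s \<le> \<phi>' s" if s: "0 \<le> s" "s \<le> 1" for s
  proof -
    have "weights_on N (W s N)"
      unfolding W_def using assms(1) sx[OF s] by (rule weights_on_indep_weight)
    then have "c - \<phi> s = (\<Sum>S\<in>Pow N. W s N S * (c - f S))"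
      by (simp add: \<phi>_def weights_on_def right_diff_distrib sum_subtractf flip: sum_distrib_right)
    \<comment> \<open>The bound for a fixed \<open>S\<close> is averaged over a random
      \<open>S\<close> that contains each \<open>i\<close> independently with probability
      \<open>s * x i\<close>.\<close>
    also have "\<dots> \<le> (\<Sum>S\<in>Pow N. W s N S * (\<Sum>i\<in>N. x i * (f (insert i S) - f S)))"
      using expectation_le_marginals[OF assms(1) mono f u] W_nonneg[OF s]
      by (intro sum_mono mult_left_mono) (auto simp: c_def algebra_simps)
    also have "\<dots> = (\<Sum>i\<in>N. x i * (\<Sum>S\<in>Pow N. W s N S * (f (insert i S) - f S)))"
      unfolding sum_distrib_left by (subst sum.swap) (simp add: mult_ac)
    also have "\<dots> \<le> \<phi>' s"
      unfolding \<phi>'_def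
    proof (intro sum_mono mult_left_mono)
      fix i assume i: "i \<in> N"
      show "0 \<le> x i"
        using x i by auto
      have "(\<Sum>S\<in>Pow N. W s N S * (f (insert i S) - f S)) =
          (\<Sum>S\<in>Pow (N - {i}). (1 - s * x i) * (W s (N - {i}) S * (f (insert i S) - f S)))"
        unfolding sum_Pow_remove[OF assms(1) i] W_def
        by (rule sum.cong) (use i in \<open>auto simp: indep_weight_remove[OF assms(1) i]\<close>)
      also have "\<dots> \<le> (\<Sum>S\<in>Pow (N - {i}). W s (N - {i}) S * (f (insert i S) - f S))"
      proof (intro sum_mono mult_left_le_one_le mult_nonneg_nonneg)
        fix S assume "S \<in> Pow (N - {i})"
        then show "0 \<le> f (insert i S) - f S"
          using i mono_onD[OF mono, of S "insert i S"] by auto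
      qed (use W_nonneg[OF s] sx[OF s i] in auto)
      finally show "(\<Sum>S\<in>Pow N. W s N S * (f (insert i S) - f S)) \<le>
          (\<Sum>S\<in>Pow (N - {i}). W s (N - {i}) S * (f (insert i S) - f S))" .
    qed
    finally show ?thesis .
  qed
  have "exp 0 * (\<phi> 0 - c) \<le> exp 1 * (\<phi> 1 - c)"
  proof (rule DERIV_nonneg_imp_nondecreasing[of 0 1 "\<lambda>s. exp s * (\<phi> s - c)"])
    fix s :: real assume s: "0 \<le> s" "s \<le> 1"
    have "((\<lambda>s. exp s * (\<phi> s - c)) has_field_derivative exp s * (\<phi> s - c + \<phi>' s)) (at s)"
      using deriv[of s] by (auto intro!: derivative_eq_intros simp: algebra_simps)
    moreover have "0 \<le> exp s * (\<phi> s - c + \<phi>' s)"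
      using \<phi>'_ge[OF s] by simp
    ultimately show "\<exists>y. ((\<lambda>s. exp s * (\<phi> s - c)) has_real_derivative y) (at s) \<and> 0 \<le> y"
      by blast
  qed simp
  \<comment> \<open>Only the sign of \<open>\<phi> 0\<close> matters: then
    \<open>- c \<le> exp 1 * (\<phi> 1 - c)\<close>, which is where the factor
    \<open>1 - exp (-1)\<close> originates.\<close>
  moreover have "0 \<le> \<phi> 0"
    unfolding \<phi>_def using W_nonneg nonneg by (intro sum_nonneg mult_nonneg_nonneg) auto
  ultimately have "c - exp (-1) * c \<le> \<phi> 1"
    by (simp add: exp_minus field_simps)
  then show ?thesis
    by (simp add: c_def \<phi>_def W_def algebra_simps)
qed

section \<open>The two extensions\<close>

text \<open>The independent distribution has marginals \<open>x\<close>, so the feasible set is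
  nonempty and the maximum exists.\<close>

lemma concave_closure_maximum:
  assumes "finite N" and x: "\<And>i. i \<in> N \<Longrightarrow> 0 \<le> x i \<and> x i \<le> 1"
  shows "\<exists>u. weights_on N u \<and> (\<forall>i\<in>N. (\<Sum>S | S \<subseteq> N \<and> i \<in> S. u S) = x i) \<and>
      concave_closure N f x = (\<Sum>S\<in>Pow N. u S * f S)"
    and "\<And>u. weights_on N u \<Longrightarrow> (\<And>i. i \<in> N \<Longrightarrow> (\<Sum>S | S \<subseteq> N \<and> i \<in> S. u S) = x i) \<Longrightarrow>
      (\<Sum>S\<in>Pow N. u S * f S) \<le> concave_closure N f x"
proof -
  let ?Q = "moment_polytope N N (\<lambda>i. {S. S \<subseteq> N \<and> i \<in> S}) x"
  have "indep_weight N x \<in> ?Q"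
    using weights_on_indep_weight[OF assms] sum_indep_weight_superset[OF assms(1), of "{_}" x]
    by (simp add: moment_polytope_def)
  then have ne: "?Q \<noteq> {}"
    by blast
  have eq: "concave_closure N f x = (GREATEST v. \<exists>p\<in>?Q. v = (\<Sum>S\<in>Pow N. p S * f S))"
    by (simp add: concave_closure_def moment_polytope_def Bex_def)
  have sub: "{S. S \<subseteq> N \<and> i \<in> S} \<subseteq> Pow N" for i
    by auto
  note max = moment_polytope_attains_Greatest[OF assms(1) sub ne, of f, folded eq]
  show "\<exists>u. weights_on N u \<and> (\<forall>i\<in>N. (\<Sum>S | S \<subseteq> N \<and> i \<in> S. u S) = x i) \<and>
      concave_closure N f x = (\<Sum>S\<in>Pow N. u S * f S)"
    using max(1) by (auto simp: moment_polytope_def)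
  show "(\<Sum>S\<in>Pow N. u S * f S) \<le> concave_closure N f x"
    if "weights_on N u" "\<And>i. i \<in> N \<Longrightarrow> (\<Sum>S | S \<subseteq> N \<and> i \<in> S. u S) = x i" for u
  proof -
    have "u \<in> ?Q"
      using that by (simp add: moment_polytope_def)
    with max(2) show ?thesis
      by (rule bspec)
  qed
qed

text \<open>The independent distribution satisfies the product condition for every \<open>I\<close>,
  hence is feasible for every \<open>t\<close>; the second claim compares its value with the
  maximum.\<close>

lemma twise_extension_maximum:
  assumes "finite N" and x: "\<And>i. i \<in> N \<Longrightarrow> 0 \<le> x i \<and> x i \<le> 1"
  shows "\<exists>p. weights_on N p \<and>
      (\<forall>I. I \<subseteq> N \<and> 1 \<le> card I \<and> card I \<le> t \<longrightarrow> (\<Sum>S | S \<subseteq> N \<and> I \<subseteq> S. p S) = (\<Prod>i\<in>I. x i)) \<and>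
      twise_extension t N f x = (\<Sum>S\<in>Pow N. p S * f S)"
    and "(\<Sum>S\<in>Pow N. indep_weight N x S * f S) \<le> twise_extension t N f x"
proof -
  let ?J = "{I. I \<subseteq> N \<and> 1 \<le> card I \<and> card I \<le> t}"
  let ?Q = "moment_polytope N ?J (\<lambda>I. {S. S \<subseteq> N \<and> I \<subseteq> S}) (\<lambda>I. \<Prod>i\<in>I. x i)"
  have indep: "indep_weight N x \<in> ?Q"
    using weights_on_indep_weight[OF assms] sum_indep_weight_superset[OF assms(1), of _ x]
    by (simp add: moment_polytope_def)
  then have ne: "?Q \<noteq> {}"
    by blast
  have eq: "twise_extension t N f x = (GREATEST v. \<exists>p\<in>?Q. v = (\<Sum>S\<in>Pow N. p S * f S))"
    by (simp add: twise_extension_def moment_polytope_def Bex_def)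
  have sub: "{S. S \<subseteq> N \<and> I \<subseteq> S} \<subseteq> Pow N" for I
    by auto
  note max = moment_polytope_attains_Greatest[OF assms(1) sub ne, of f, folded eq]
  show "\<exists>p. weights_on N p \<and>
      (\<forall>I. I \<subseteq> N \<and> 1 \<le> card I \<and> card I \<le> t \<longrightarrow> (\<Sum>S | S \<subseteq> N \<and> I \<subseteq> S. p S) = (\<Prod>i\<in>I. x i)) \<and>
      twise_extension t N f x = (\<Sum>S\<in>Pow N. p S * f S)"
    using max(1) by (auto simp: moment_polytope_def)
  show "(\<Sum>S\<in>Pow N. indep_weight N x S * f S) \<le> twise_extension t N f x"
    using max(2) indep by (rule bspec)
qed

corollary concave_closure_le_twise_extension:
  assumes "finite N" "\<And>S. S \<subseteq> N \<Longrightarrow> f S \<ge> 0" "mono_on (Pow N) f" "submodular_on N f"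
    and x: "\<And>i. i \<in> N \<Longrightarrow> 0 \<le> x i \<and> x i \<le> 1"
  shows "(1 - exp (-1)) * concave_closure N f x \<le> twise_extension t N f x"
proof -
  obtain u where u: "weights_on N u" "\<And>i. i \<in> N \<Longrightarrow> (\<Sum>S | S \<subseteq> N \<and> i \<in> S. u S) = x i"
      "concave_closure N f x = (\<Sum>S\<in>Pow N. u S * f S)"
    using concave_closure_maximum(1)[OF assms(1), of x f] x by blast
  have "(1 - exp (-1)) * concave_closure N f x \<le> (\<Sum>S\<in>Pow N. indep_weight N x S * f S)"
    unfolding u(3) by (rule correlation_gap) (use assms u in auto)
  also have "\<dots> \<le> twise_extension t N f x"
    using assms(1) x by (rule twise_extension_maximum(2))
  finally show ?thesis .
qed

section \<open>Hitting transversals\<close>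

lemma hit_count_mono: "mono_on X (hit_count m (A :: nat \<Rightarrow> 'a set))"
proof (rule mono_onI)
  fix S T :: "'a set" assume "S \<subseteq> T"
  then have "of_bool (S \<inter> H \<noteq> {}) \<le> (of_bool (T \<inter> H \<noteq> {}) :: real)" for H
    by (cases "S \<inter> H = {}") auto
  then show "hit_count m A S \<le> hit_count m A T"
    unfolding hit_count_def by (intro sum_mono)
qed

text \<open>It suffices to check each transversal: if \<open>S \<inter> T\<close> hits it, so do
  both sets, and if \<open>S \<union> T\<close> hits it, so does one of them.\<close>

lemma hit_count_submodular: "submodular_on N (hit_count m (A :: nat \<Rightarrow> 'a set))"
proof -
  have "of_bool (S \<inter> T \<inter> H \<noteq> {}) + of_bool ((S \<union> T) \<inter> H \<noteq> {}) \<le>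
      (of_bool (S \<inter> H \<noteq> {}) + of_bool (T \<inter> H \<noteq> {}) :: real)" for S T H :: "'a set"
    by (cases "S \<inter> H = {}"; cases "T \<inter> H = {}") (auto simp: Int_Un_distrib2)
  then show ?thesis
    unfolding submodular_on_def hit_count_def sum.distrib[symmetric] by (intro allI impI sum_mono)
qed

lemma hit_count_nonneg: "0 \<le> hit_count m A S"
  unfolding hit_count_def by (rule sum_nonneg) auto

text \<open>Count the complement: the missed transversals are those of the blocks
  \<open>A r - S\<close>. By disjointness an entry reveals its block, so a tuple is recovered from
  its set of entries and products of cardinalities count transversals.\<close>

lemma hit_count_eq:
  assumes fin: "\<And>r. r \<in> {1..m} \<Longrightarrow> finite (A r)" and disj: "disjoint_family_on A {1..m}"
  shows "hit_count m A S = (\<Prod>r=1..m. real (card (A r))) - (\<Prod>r=1..m. real (card (A r - S)))"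
proof -
  have inj: "inj_on (\<lambda>h. h ` {1..m}) (\<Pi>\<^sub>E r\<in>{1..m}. A r)"
  proof (rule inj_onI)
    fix g h assume gh: "g \<in> (\<Pi>\<^sub>E r\<in>{1..m}. A r)" "h \<in> (\<Pi>\<^sub>E r\<in>{1..m}. A r)" "g ` {1..m} = h ` {1..m}"
    show "g = h"
    proof (rule PiE_ext[OF gh(1,2)])
      fix r assume r: "r \<in> {1..m}"
      then obtain s where s: "s \<in> {1..m}" "g r = h s"
        using gh(3) by blast
      have "g r \<in> A r" "g r \<in> A s"
        using r s PiE_mem[OF gh(1) r] PiE_mem[OF gh(2) s(1)] by auto
      then have "r = s"
        using disjoint_family_onD[OF disj r s(1)] by blast
      with s show "g r = h r" by simp
    qed
  qed
  have card: "card ((\<lambda>h. h ` {1..m}) ` (\<Pi>\<^sub>E r\<in>{1..m}. A r - X)) = (\<Prod>r=1..m. card (A r - X))" for X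
  proof -
    have "inj_on (\<lambda>h. h ` {1..m}) (\<Pi>\<^sub>E r\<in>{1..m}. A r - X)"
      by (rule inj_on_subset[OF inj]) (rule PiE_mono, auto)
    then show ?thesis
      by (simp add: card_image card_PiE)
  qed
  let ?T = "transversals m A"
  have "finite ?T"
    unfolding transversals_def using fin by (intro finite_imageI finite_PiE) auto
  have miss: "{H \<in> ?T. S \<inter> H = {}} = (\<lambda>h. h ` {1..m}) ` (\<Pi>\<^sub>E r\<in>{1..m}. A r - S)"
    unfolding transversals_def by (auto simp: PiE_iff image_iff; fastforce)
  have "hit_count m A S = real (card {H \<in> ?T. S \<inter> H \<noteq> {}})"
    unfolding hit_count_def using \<open>finite ?T\<close> by (simp add: sum.If_cases of_bool_def Int_def)
  also have "{H \<in> ?T. S \<inter> H \<noteq> {}} = ?T - {H \<in> ?T. S \<inter> H = {}}"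
    by auto
  also have "card \<dots> = card ?T - card {H \<in> ?T. S \<inter> H = {}}"
    using \<open>finite ?T\<close> by (intro card_Diff_subset) auto
  also have "real \<dots> = real (card ?T) - real (card {H \<in> ?T. S \<inter> H = {}})"
    using \<open>finite ?T\<close> by (intro of_nat_diff card_mono) auto
  finally show ?thesis
    using card[of "{}"] card[of S] unfolding miss by (simp add: transversals_def)
qed

section \<open>Moments of block intersections and the resulting bound on the expected hit
  count\<close>

lemma sum_weight_card_Int:
  fixes p :: "'a set \<Rightarrow> real"
  assumes "finite N" "B \<subseteq> N" "\<And>i. i \<in> B \<Longrightarrow> (\<Sum>S | S \<subseteq> N \<and> i \<in> S. p S) = q"
  shows "(\<Sum>S\<in>Pow N. p S * real (card (S \<inter> B))) = real (card B) * q"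
proof -
  have "finite B"
    using assms finite_subset by auto
  then have "(\<Sum>S\<in>Pow N. p S * real (card (S \<inter> B))) = (\<Sum>S\<in>Pow N. \<Sum>i\<in>B. p S * of_bool (i \<in> S))"
    by (simp add: Int_commute flip: sum_distrib_left)
  also have "\<dots> = (\<Sum>i\<in>B. \<Sum>S\<in>Pow N. p S * of_bool (i \<in> S))"
    by (rule sum.swap)
  also have "\<dots> = (\<Sum>i\<in>B. \<Sum>S | S \<subseteq> N \<and> i \<in> S. p S)"
    using assms(1) by (intro sum.cong sum.mono_neutral_cong_right) auto
  finally show ?thesis
    using assms(3) by simp
qed

lemma sum_weight_card_Int_squared_le:
  fixes p :: "'a set \<Rightarrow> real"
  assumes "finite N" "B \<subseteq> N" "\<And>i. i \<in> B \<Longrightarrow> (\<Sum>S | S \<subseteq> N \<and> i \<in> S. p S) = q"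
    and pair: "\<And>i j. i \<in> B \<Longrightarrow> j \<in> B \<Longrightarrow> i \<noteq> j \<Longrightarrow> (\<Sum>S | S \<subseteq> N \<and> {i, j} \<subseteq> S. p S) = q\<^sup>2"
  shows "(\<Sum>S\<in>Pow N. p S * (real (card (S \<inter> B)))\<^sup>2) \<le> real (card B) * q + (real (card B) * q)\<^sup>2"
proof -
  have fin: "finite B"
    using assms finite_subset by auto
  then have card: "real (card (S \<inter> B)) = (\<Sum>i\<in>B. of_bool (i \<in> S))" for S
    by (simp add: Int_commute)
  have "(\<Sum>S\<in>Pow N. p S * (real (card (S \<inter> B)))\<^sup>2) =
      (\<Sum>S\<in>Pow N. \<Sum>i\<in>B. \<Sum>j\<in>B. p S * of_bool ({i, j} \<subseteq> S))"
    unfolding card power2_eq_square sum_product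
    unfolding sum_distrib_left
    by (intro sum.cong refl) (auto simp: of_bool_def)
  also have "\<dots> = (\<Sum>i\<in>B. \<Sum>j\<in>B. \<Sum>S\<in>Pow N. p S * of_bool ({i, j} \<subseteq> S))"
    by (subst sum.swap, subst (2) sum.swap) (rule refl)
  also have "\<dots> = (\<Sum>i\<in>B. \<Sum>j\<in>B. \<Sum>S | S \<subseteq> N \<and> {i, j} \<subseteq> S. p S)"
    using assms(1) by (intro sum.cong refl sum.mono_neutral_cong_right) auto
  \<comment> \<open>A diagonal term is only \<open>q\<close>; granting it an extra
    \<open>q\<^sup>2\<close> makes the double sum a perfect square plus
    \<open>card B * q\<close>.\<close>
  also have "\<dots> \<le> (\<Sum>i\<in>B. \<Sum>j\<in>B. (if i = j then q else 0) + q\<^sup>2)"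
  proof (intro sum_mono)
    fix i j assume "i \<in> B" "j \<in> B"
    then show "(\<Sum>S | S \<subseteq> N \<and> {i, j} \<subseteq> S. p S) \<le> (if i = j then q else 0) + q\<^sup>2"
      using assms(3)[of i] pair[of i j] by (cases "i = j") auto
  qed
  also have "\<dots> = real (card B) * q + (real (card B) * q)\<^sup>2"
    using fin by (simp add: sum.distrib power2_eq_square algebra_simps)
  finally show ?thesis .
qed

text \<open>Replace each factor \<open>1 - y r\<close> by \<open>exp (- y r)\<close> at cost
  \<open>(y r)\<^sup>2\<close>, then bound the exponential of minus the sum below by its tangent at
  1.\<close>

lemma prod_one_minus_ge:
  fixes y :: "'a \<Rightarrow> real"
  assumes "\<And>r. r \<in> R \<Longrightarrow> 0 \<le> y r \<and> y r \<le> 1"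
  shows "exp (-1) * (2 - (\<Sum>r\<in>R. y r)) - (\<Sum>r\<in>R. (y r)\<^sup>2) \<le> (\<Prod>r\<in>R. 1 - y r)"
proof (cases "finite R")
  case True
  have single: "\<bar>exp (- z) - (1 - z)\<bar> \<le> z\<^sup>2" if "0 \<le> z" for z :: real
  proof -
    have "exp (- z) \<le> 1 / (1 + z)"
      using exp_ge_add_one_self[of z] that by (simp add: exp_minus field_simps)
    also have "\<dots> = 1 - z + z\<^sup>2 / (1 + z)"
      using that by (simp add: field_simps power2_eq_square)
    also have "\<dots> \<le> 1 - z + z\<^sup>2"
      using that by (simp add: divide_le_eq mult_nonneg_nonneg algebra_simps)
    finally show ?thesis
      using exp_ge_add_one_self[of "-z"] by simp
  qed
  let ?s = "\<Sum>r\<in>R. y r"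
  have "exp (-1) * (2 - ?s) \<le> exp (-1) * exp (1 - ?s)"
    using exp_ge_add_one_self[of "1 - ?s"] by (intro mult_left_mono) auto
  also have "\<dots> = exp (- ?s)"
    by (simp flip: exp_add)
  also have "\<dots> = (\<Prod>r\<in>R. exp (- y r))"
    using True by (simp add: exp_sum flip: sum_negf)
  \<comment> \<open>All factors lie in [0, 1], so exchanging them one at a time costs at most the
    sum of the individual differences.\<close>
  also have "\<dots> \<le> (\<Prod>r\<in>R. 1 - y r) + (\<Sum>r\<in>R. \<bar>exp (- y r) - (1 - y r)\<bar>)"
    using norm_prod_diff[of R "\<lambda>r. exp (- y r)" "\<lambda>r. 1 - y r"] assms by force
  also have "\<dots> \<le> (\<Prod>r\<in>R. 1 - y r) + (\<Sum>r\<in>R. (y r)\<^sup>2)"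
    using assms single by (intro add_left_mono sum_mono) auto
  finally show ?thesis
    by simp
next
  case False
  \<comment> \<open>Over an infinite \<open>R\<close> both sums default to 0 and the product to 1,
    which leaves this inequality.\<close>
  have "2 * exp (-1 :: real) \<le> 1"
    using exp_ge_add_one_self[of "1::real"] by (simp add: exp_minus field_simps)
  with False show ?thesis
    by simp
qed

text \<open>For a block of size a, \<open>(Y S r)\<^sup>2\<close> has mean at most (1/a + 1/m)/m;
  summing over m blocks with a at least \<open>l\<close> gives the error 1/l + 1/m.\<close>

lemma pairwise_hit_count_le:
  assumes "1 \<le> m" "0 < l" and N: "finite N" "(\<Union>r\<in>{1..m}. A r) = N"
    and disj: "disjoint_family_on A {1..m}" and l: "\<And>r. r \<in> {1..m} \<Longrightarrow> l \<le> card (A r)"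
    and p: "weights_on N p" "\<And>i. i \<in> N \<Longrightarrow> (\<Sum>S | S \<subseteq> N \<and> i \<in> S. p S) = 1 / real m"
      "\<And>i j. i \<in> N \<Longrightarrow> j \<in> N \<Longrightarrow> i \<noteq> j \<Longrightarrow> (\<Sum>S | S \<subseteq> N \<and> {i, j} \<subseteq> S. p S) = (1 / real m)\<^sup>2"
  shows "(\<Sum>S\<in>Pow N. p S * hit_count m A S) \<le>
    (\<Prod>r=1..m. real (card (A r))) * (1 - exp (-1) + 1 / real l + 1 / real m)"
proof -
  define M where "M = (\<Prod>r=1..m. real (card (A r)))"
  define Y where "Y S r = real (card (S \<inter> A r)) / real (card (A r))" for S r
  let ?E = "\<lambda>g. \<Sum>S\<in>Pow N. p S * g S"
  have sub: "A r \<subseteq> N" if "r \<in> {1..m}" for r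
    using N(2) that by blast
  have fin: "finite (A r)" if "r \<in> {1..m}" for r
    using sub[OF that] N(1) finite_subset by blast
  have pos: "0 < card (A r)" if "r \<in> {1..m}" for r
    using l[OF that] \<open>0 < l\<close> by linarith
  have Y01: "0 \<le> Y S r \<and> Y S r \<le> 1" if "r \<in> {1..m}" for S r
    using pos[OF that] fin[OF that] by (simp add: Y_def card_mono)
  have hit: "hit_count m A S = M * (1 - (\<Prod>r=1..m. 1 - Y S r))" for S
  proof -
    have "real (card (A r - S)) = real (card (A r)) * (1 - Y S r)" if "r \<in> {1..m}" for r
    proof -
      have "card (A r) = card (A r - S) + card (S \<inter> A r)"
        using card_Diff_subset_Int[of "A r" S] fin[OF that] card_mono[of "A r" "A r \<inter> S"]
        by (simp add: Int_commute)
      then have "real (card (A r - S)) = real (card (A r)) - real (card (S \<inter> A r))"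
        by simp
      then show ?thesis
        using pos[OF that] by (simp add: Y_def right_diff_distrib)
    qed
    then have "(\<Prod>r=1..m. real (card (A r - S))) = M * (\<Prod>r=1..m. 1 - Y S r)"
      unfolding M_def prod.distrib[symmetric] by (intro prod.cong) auto
    then show ?thesis
      using hit_count_eq[of m A S] fin disj by (simp add: M_def right_diff_distrib)
  qed
  have "?E (\<lambda>S. \<Sum>r=1..m. Y S r) = (\<Sum>r=1..m. ?E (\<lambda>S. Y S r))"
    unfolding sum_distrib_left by (rule sum.swap)
  also have "\<dots> = (\<Sum>r=1..m. 1 / real m)"
  proof (rule sum.cong[OF refl])
    fix r assume r: "r \<in> {1..m}"
    have "?E (\<lambda>S. Y S r) = ?E (\<lambda>S. real (card (S \<inter> A r))) / real (card (A r))"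
      by (simp add: Y_def sum_divide_distrib)
    also have "?E (\<lambda>S. real (card (S \<inter> A r))) = real (card (A r)) * (1 / real m)"
      using sub[OF r] p(2) by (intro sum_weight_card_Int N(1)) auto
    finally show "?E (\<lambda>S. Y S r) = 1 / real m"
      using pos[OF r] by simp
  qed
  finally have E1: "?E (\<lambda>S. \<Sum>r=1..m. Y S r) = 1"
    using \<open>1 \<le> m\<close> by simp
  have "?E (\<lambda>S. \<Sum>r=1..m. (Y S r)\<^sup>2) = (\<Sum>r=1..m. ?E (\<lambda>S. (Y S r)\<^sup>2))"
    unfolding sum_distrib_left by (rule sum.swap)
  also have "\<dots> \<le> (\<Sum>r=1..m. (1 / real l + 1 / real m) / real m)"
  proof (rule sum_mono)
    fix r assume r: "r \<in> {1..m}"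
    let ?a = "real (card (A r))"
    have "?E (\<lambda>S. (Y S r)\<^sup>2) = ?E (\<lambda>S. (real (card (S \<inter> A r)))\<^sup>2) / ?a\<^sup>2"
      by (simp add: Y_def sum_divide_distrib power_divide)
    also have "\<dots> \<le> (?a * (1 / real m) + (?a * (1 / real m))\<^sup>2) / ?a\<^sup>2"
      using sub[OF r]
      by (intro divide_right_mono sum_weight_card_Int_squared_le N(1) p(2,3)) auto
    also have "\<dots> = (1 / ?a + 1 / real m) / real m"
      using pos[OF r] \<open>1 \<le> m\<close> by (simp add: field_simps power2_eq_square)
    also have "\<dots> \<le> (1 / real l + 1 / real m) / real m"
      using l[OF r] \<open>0 < l\<close> by (intro divide_right_mono add_right_mono) (auto intro!: divide_left_mono)
    finally show "?E (\<lambda>S. (Y S r)\<^sup>2) \<le> (1 / real l + 1 / real m) / real m" .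
  qed
  finally have E2: "?E (\<lambda>S. \<Sum>r=1..m. (Y S r)\<^sup>2) \<le> 1 / real l + 1 / real m"
    using \<open>1 \<le> m\<close> by simp
  have "?E (hit_count m A) \<le>
      ?E (\<lambda>S. M * (1 - (exp (-1) * (2 - (\<Sum>r=1..m. Y S r)) - (\<Sum>r=1..m. (Y S r)\<^sup>2))))"
    unfolding hit using p(1) Y01
    by (intro sum_mono mult_left_mono diff_left_mono prod_one_minus_ge)
       (auto simp: weights_on_def M_def intro: prod_nonneg)
  \<comment> \<open>Total mass and mean of the sum both equal 1, so the constants combine to 1 - 2/e
    + 1/e = 1 - 1/e.\<close>
  also have "\<dots> = M * ((1 - 2 * exp (-1)) * (\<Sum>S\<in>Pow N. p S) + exp (-1) * ?E (\<lambda>S. \<Sum>r=1..m. Y S r)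
      + ?E (\<lambda>S. \<Sum>r=1..m. (Y S r)\<^sup>2))"
    unfolding distrib_left sum_distrib_left[of M] sum_distrib_left[of "exp (-1)"]
      sum_distrib_left[of "1 - 2 * exp (-1)"] sum.distrib[symmetric]
    by (intro sum.cong refl) (simp add: algebra_simps)
  also have "\<dots> \<le> M * (1 - exp (-1) + 1 / real l + 1 / real m)"
    using E1 E2 p(1) by (intro mult_left_mono) (auto simp: weights_on_def M_def intro: prod_nonneg)
  finally show ?thesis
    by (simp add: M_def)
qed

text \<open>The maximum is attained by the uniform distribution on the blocks, since every block meets
  every transversal.\<close>

lemma concave_closure_hit_count:
  fixes A :: "nat \<Rightarrow> 'a set"
  assumes "1 \<le> m" and N: "finite N" "(\<Union>r\<in>{1..m}. A r) = N"
    and disj: "disjoint_family_on A {1..m}" and ne: "\<And>r. r \<in> {1..m} \<Longrightarrow> A r \<noteq> {}"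
  shows "concave_closure N (hit_count m A) (\<lambda>i. 1 / real m) = (\<Prod>r=1..m. real (card (A r)))"
proof (rule antisym)
  let ?M = "\<Prod>r=1..m. real (card (A r))"
  have x: "0 \<le> 1 / real m \<and> 1 / real m \<le> 1"
    using \<open>1 \<le> m\<close> by simp
  have sub: "A r \<subseteq> N" if "r \<in> {1..m}" for r
    using N(2) that by blast
  have fin: "finite (A r)" if "r \<in> {1..m}" for r
    using sub[OF that] N(1) finite_subset by blast
  have le: "hit_count m A S \<le> ?M" for S
    using hit_count_eq[of m A S] fin disj by (simp add: prod_nonneg)
  have hit: "hit_count m A (A r) = ?M" if "r \<in> {1..m}" for r
    using hit_count_eq[of m A "A r"] fin disj that by auto
  \<comment> \<open>Two equal blocks with different indices would be disjoint, hence empty.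
    Distinctness lets each block carry its own mass 1/m.\<close>
  have inj: "inj_on A {1..m}"
    using disj ne by (intro inj_onI) (metis disjoint_family_onD inf.idem)
  show "concave_closure N (hit_count m A) (\<lambda>i. 1 / real m) \<le> ?M"
  proof -
    obtain u where u: "weights_on N u"
        "concave_closure N (hit_count m A) (\<lambda>i. 1 / real m) = (\<Sum>S\<in>Pow N. u S * hit_count m A S)"
      using concave_closure_maximum(1)[OF N(1), of "\<lambda>i. 1 / real m" "hit_count m A"] x by blast
    have "(\<Sum>S\<in>Pow N. u S * hit_count m A S) \<le> (\<Sum>S\<in>Pow N. u S * ?M)"
      using u(1) le by (intro sum_mono mult_left_mono) (auto simp: weights_on_def)
    also have "\<dots> = ?M"
      using u(1) by (simp add: weights_on_def flip: sum_distrib_right)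
    finally show ?thesis
      using u(2) by simp
  qed
  let ?u = "\<lambda>S. if S \<in> A ` {1..m} then 1 / real m else 0"
  \<comment> \<open>One formula for three uses: \<open>g\<close> constantly 1 gives the total mass
    and the marginals, \<open>g\<close> the hit count gives the objective.\<close>
  have blocks: "(\<Sum>S\<in>F. ?u S * g S) = (\<Sum>r | r \<in> {1..m} \<and> A r \<in> F. 1 / real m * g (A r))"
    if "F \<subseteq> Pow N" for F and g :: "'a set \<Rightarrow> real"
  proof -
    have "finite F"
      using that N(1) finite_subset by blast
    have "(\<Sum>S\<in>F. ?u S * g S) = (\<Sum>S\<in>A ` {r \<in> {1..m}. A r \<in> F}. 1 / real m * g S)"
      using \<open>finite F\<close> by (intro sum.mono_neutral_cong_right) auto
    also have "\<dots> = (\<Sum>r | r \<in> {1..m} \<and> A r \<in> F. 1 / real m * g (A r))"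
      using inj by (subst sum.reindex) (auto intro: inj_on_subset)
    finally show ?thesis .
  qed
  have all: "{r \<in> {1..m}. A r \<in> Pow N} = {1..m}"
    using sub by blast
  have "weights_on N ?u"
    using blocks[of "Pow N" "\<lambda>_. 1"] all \<open>1 \<le> m\<close> by (simp add: weights_on_def)
  moreover have "(\<Sum>S | S \<subseteq> N \<and> i \<in> S. ?u S) = 1 / real m" if "i \<in> N" for i
  proof -
    obtain r where r: "r \<in> {1..m}" "i \<in> A r"
      using N(2) \<open>i \<in> N\<close> by blast
    have "s = r" if "s \<in> {1..m}" "i \<in> A s" for s
      using disjoint_family_onD[OF disj that(1) r(1)] that(2) r(2) by blast
    with r have "{r \<in> {1..m}. A r \<in> {S. S \<subseteq> N \<and> i \<in> S}} = {r}"
      using sub by blast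
    then show ?thesis
      using blocks[of "{S. S \<subseteq> N \<and> i \<in> S}" "\<lambda>_. 1"] by auto
  qed
  moreover have "(\<Sum>S\<in>Pow N. ?u S * hit_count m A S) = ?M"
    using blocks[of "Pow N" "hit_count m A"] all hit \<open>1 \<le> m\<close> by simp
  ultimately show "?M \<le> concave_closure N (hit_count m A) (\<lambda>i. 1 / real m)"
    using concave_closure_maximum(2)[OF N(1), of "\<lambda>i. 1 / real m" ?u "hit_count m A"] x by simp
qed

section \<open>The ratio for the block construction and its limit\<close>

lemma hit_count_ratio_bounds:
  assumes "t \<ge> 2" "1 \<le> m" "m \<le> n" and part: "block_partition n m A"
  defines "R \<equiv> concave_closure {1..n} (hit_count m A) (\<lambda>i. 1 / real m) /
                twise_extension t {1..n} (hit_count m A) (\<lambda>i. 1 / real m)"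
  shows "1 / (1 - exp (-1) + 1 / real (n div m) + 1 / real m) \<le> R" "R \<le> 1 / (1 - exp (-1))"
proof -
  define M where "M = (\<Prod>r=1..m. real (card (A r)))"
  define T where "T = twise_extension t {1..n} (hit_count m A) (\<lambda>i. 1 / real m)"
  have N: "(\<Union>r\<in>{1..m}. A r) = {1..n}" and disj: "disjoint_family_on A {1..m}"
    using part by (auto simp: block_partition_def)
  have l: "0 < n div m"
    using assms(2,3) by (simp add: div_greater_zero_iff)
  have card: "n div m \<le> card (A r)" if r: "r \<in> {1..m}" for r
  proof (cases "r = m")
    case True
    have "m * (n div m) \<le> n"
      by simp
    \<comment> \<open>The last block absorbs the remainder of the division, so it is at least as
      large as the others.\<close>
    then have "n div m \<le> n - (m - 1) * (n div m)"
      using \<open>1 \<le> m\<close> by (cases m) auto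
    then show ?thesis
      using part True by (simp add: block_partition_def)
  next
    case False
    then show ?thesis
      using part r by (auto simp: block_partition_def)
  qed
  have ne: "A r \<noteq> {}" if "r \<in> {1..m}" for r
    using card[OF that] l by auto
  have x: "0 \<le> 1 / real m \<and> 1 / real m \<le> 1"
    using \<open>1 \<le> m\<close> by simp
  have "M > 0"
    unfolding M_def using card l by (intro prod_pos) fastforce
  have cc: "concave_closure {1..n} (hit_count m A) (\<lambda>i. 1 / real m) = M"
    unfolding M_def using N disj ne \<open>1 \<le> m\<close> by (intro concave_closure_hit_count) auto
  have e: "0 < 1 - exp (-1 :: real)"
    by simp
  have lower: "(1 - exp (-1)) * M \<le> T"
    unfolding T_def cc[symmetric]
    by (rule concave_closure_le_twise_extension)
       (use x hit_count_nonneg hit_count_mono hit_count_submodular in auto)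
  then have "T > 0"
    using \<open>M > 0\<close> e by (meson less_le_trans mult_pos_pos)
  obtain p where p: "weights_on {1..n} p"
      "\<And>I. I \<subseteq> {1..n} \<Longrightarrow> 1 \<le> card I \<Longrightarrow> card I \<le> t \<Longrightarrow>
        (\<Sum>S | S \<subseteq> {1..n} \<and> I \<subseteq> S. p S) = (\<Prod>i\<in>I. 1 / real m)"
      "T = (\<Sum>S\<in>Pow {1..n}. p S * hit_count m A S)"
    unfolding T_def
    using twise_extension_maximum(1)[of "{1..n}" "\<lambda>i. 1 / real m" t "hit_count m A"] x by auto
  have upper: "T \<le> M * (1 - exp (-1) + 1 / real (n div m) + 1 / real m)"
    unfolding p(3) M_def
  proof (rule pairwise_hit_count_le[OF \<open>1 \<le> m\<close> l _ N disj card p(1)])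
    show "(\<Sum>S | S \<subseteq> {1..n} \<and> i \<in> S. p S) = 1 / real m" if "i \<in> {1..n}" for i
      using p(2)[of "{i}"] that \<open>t \<ge> 2\<close> by simp
    show "(\<Sum>S | S \<subseteq> {1..n} \<and> {i, j} \<subseteq> S. p S) = (1 / real m)\<^sup>2"
      if "i \<in> {1..n}" "j \<in> {1..n}" "i \<noteq> j" for i j
      using p(2)[of "{i, j}"] that \<open>t \<ge> 2\<close> by (simp add: power2_eq_square)
  qed auto
  have "R = M / T"
    unfolding R_def cc T_def ..
  have "0 < 1 - exp (-1) + 1 / real (n div m) + 1 / real m"
    using e by (intro add_pos_nonneg) auto
  then show "1 / (1 - exp (-1) + 1 / real (n div m) + 1 / real m) \<le> R"
    unfolding \<open>R = M / T\<close> using upper \<open>T > 0\<close> by (simp add: divide_le_eq le_divide_eq mult.commute)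
  show "R \<le> 1 / (1 - exp (-1))"
    unfolding \<open>R = M / T\<close> using lower \<open>T > 0\<close> e by (simp add: divide_le_eq le_divide_eq mult.commute)
qed

text \<open>With l = \<open>n div m n\<close> at least 1, n < m (l + 1) is at most 2 m l, hence 1/l
  is at most 2 m/n.\<close>

lemma inverse_div_tendsto_0:
  fixes m :: "nat \<Rightarrow> nat"
  assumes m: "\<And>n. 1 \<le> n \<Longrightarrow> 1 \<le> m n \<and> m n \<le> n" and o: "(\<lambda>n. real (m n)) \<in> o(\<lambda>n. real n)"
  shows "(\<lambda>n. 1 / real (n div m n)) \<longlonglongrightarrow> 0"
proof (rule tendsto_sandwich[OF _ _ tendsto_const])
  have "(\<lambda>n. real (m n) / real n) \<longlonglongrightarrow> 0"
    using o by (rule smalloD_tendsto)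
  then show "(\<lambda>n. 2 * (real (m n) / real n)) \<longlonglongrightarrow> 0"
    by (rule tendsto_mult_right_zero)
  show "\<forall>\<^sub>F n in sequentially. 1 / real (n div m n) \<le> 2 * (real (m n) / real n)"
    using eventually_ge_at_top[of 1]
  proof eventually_elim
    case (elim n)
    then have l: "1 \<le> n div m n"
      using m[OF elim] by (simp add: Suc_leI div_greater_zero_iff)
    have "n mod m n < m n"
      using m[OF elim] by (intro mod_less_divisor) auto
    then have "n < m n * (n div m n) + m n"
      using mult_div_mod_eq[of "m n" n] by linarith
    moreover have "m n \<le> m n * (n div m n)"
      using l by simp
    ultimately have "n \<le> 2 * (m n * (n div m n))"
      by linarith
    then have "real n \<le> 2 * (real (m n) * real (n div m n))"
      by (metis of_nat_le_iff of_nat_mult of_nat_numeral)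
    then show ?case
      using elim l by (simp add: divide_le_eq le_divide_eq field_simps)
  qed
qed simp

theorem corollary6:
  fixes t :: nat
  assumes "t > 2"
  shows "(\<forall>n\<ge>1. \<forall>(f :: nat set \<Rightarrow> real) (x :: nat \<Rightarrow> real).
            (\<forall>S\<in>Pow {1..n}. f S \<ge> 0) \<longrightarrow>
            mono_on (Pow {1..n}) f \<longrightarrow>
            submodular_on {1..n} f \<longrightarrow>
            (\<forall>i\<in>{1..n}. 0 \<le> x i \<and> x i \<le> 1) \<longrightarrow>
            twise_extension t {1..n} f x > 0 \<longrightarrow>
            concave_closure {1..n} f x / twise_extension t {1..n} f x \<le> exp 1 / (exp 1 - 1))
       \<and> (\<forall>(m :: nat \<Rightarrow> nat) (A :: nat \<Rightarrow> nat \<Rightarrow> nat set).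
            (\<forall>n\<ge>1. 1 \<le> m n \<and> m n \<le> n) \<longrightarrow>
            filterlim m at_top at_top \<longrightarrow>
            (\<lambda>n. real (m n)) \<in> o(\<lambda>n. real n) \<longrightarrow>
            (\<forall>n\<ge>1. block_partition n (m n) (A n)) \<longrightarrow>
            (\<lambda>n. concave_closure {1..n} (hit_count (m n) (A n)) (\<lambda>i. 1 / real (m n)) /
                  twise_extension t {1..n} (hit_count (m n) (A n)) (\<lambda>i. 1 / real (m n)))
              \<longlonglongrightarrow> exp 1 / (exp 1 - 1))"
proof -
  have e: "exp 1 / (exp 1 - 1) = 1 / (1 - exp (-1) :: real)"
    by (simp add: exp_minus field_simps)
  have e_pos: "0 < 1 - exp (-1 :: real)"
    by simp
  show ?thesis
    unfolding e
  proof (intro conjI allI impI)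
    fix n :: nat and f :: "nat set \<Rightarrow> real" and x :: "nat \<Rightarrow> real"
    assume "\<forall>S\<in>Pow {1..n}. f S \<ge> 0" "mono_on (Pow {1..n}) f" "submodular_on {1..n} f"
      "\<forall>i\<in>{1..n}. 0 \<le> x i \<and> x i \<le> 1"
    then have "(1 - exp (-1)) * concave_closure {1..n} f x \<le> twise_extension t {1..n} f x"
      by (intro concave_closure_le_twise_extension) auto
    moreover assume "twise_extension t {1..n} f x > 0"
    ultimately show "concave_closure {1..n} f x / twise_extension t {1..n} f x \<le> 1 / (1 - exp (-1))"
      using e_pos by (simp add: divide_le_eq le_divide_eq mult.commute)
  next
    fix m :: "nat \<Rightarrow> nat" and A :: "nat \<Rightarrow> nat \<Rightarrow> nat set"
    assume m: "\<forall>n\<ge>1. 1 \<le> m n \<and> m n \<le> n" and top: "filterlim m at_top at_top"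
      and o: "(\<lambda>n. real (m n)) \<in> o(\<lambda>n. real n)" and part: "\<forall>n\<ge>1. block_partition n (m n) (A n)"
    let ?R = "\<lambda>n. concave_closure {1..n} (hit_count (m n) (A n)) (\<lambda>i. 1 / real (m n)) /
                  twise_extension t {1..n} (hit_count (m n) (A n)) (\<lambda>i. 1 / real (m n))"
    have bounds: "1 / (1 - exp (-1) + 1 / real (n div m n) + 1 / real (m n)) \<le> ?R n"
        "?R n \<le> 1 / (1 - exp (-1))" if "1 \<le> n" for n
      using hit_count_ratio_bounds[of t "m n" n "A n"] assms m part that by auto
    have "(\<lambda>n. 1 / real (m n)) \<longlonglongrightarrow> 0"
      using filterlim_compose[OF lim_1_over_n top] by simp
    with inverse_div_tendsto_0[of m] m o
    have "(\<lambda>n. 1 / (1 - exp (-1) + 1 / real (n div m n) + 1 / real (m n))) \<longlonglongrightarrow> 1 / (1 - exp (-1) + 0 + 0)"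
      using e_pos by (intro tendsto_intros) auto
    then have lim: "(\<lambda>n. 1 / (1 - exp (-1) + 1 / real (n div m n) + 1 / real (m n))) \<longlonglongrightarrow> 1 / (1 - exp (-1))"
      by simp
    show "?R \<longlonglongrightarrow> 1 / (1 - exp (-1))"
    proof (rule tendsto_sandwich[OF _ _ lim tendsto_const])
      show "\<forall>\<^sub>F n in sequentially. 1 / (1 - exp (-1) + 1 / real (n div m n) + 1 / real (m n)) \<le> ?R n"
        using eventually_ge_at_top[of 1] by eventually_elim (rule bounds(1))
      show "\<forall>\<^sub>F n in sequentially. ?R n \<le> 1 / (1 - exp (-1))"
        using eventually_ge_at_top[of 1] by eventually_elim (rule bounds(2))
    qed
  qed
qed

end
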